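(* Let $\gamma\in(0,1]$, let $D=A_2^TA_2$ or $D=\|A_2\|^2I_{n_2}$, and let $\{x^k\}=\{(x_1^k,x_2^k)\}$, $\{\lambda^k\}$ be generated, for $k\ge0$, by Algorithm 1 (given in the context), where $f_2$ is $\sigma$-strongly convex with $\sigma\ge0$. With $\breve x^k,\widetilde x^k,\bar x^k,\bar\lambda^k,\widetilde\lambda^k,v^k=(\bar x_2^k,\bar\lambda^k)$, $\widetilde v^k=(\widetilde x_2^k,\widetilde\lambda^k)$, $\widetilde u^k=(\widetilde x^k,\widetilde\lambda^k)$ and $Q^k,M^k,H^k,G^k$ as defined in the context, the following hold. (i) Suppose $\beta^k=\beta/\tau^k$ with $\beta>0$, and $1/\tau^{k-1}=(1-\tau^k)/\tau^k$ for $k\ge0$, $\tau^{-1}\in(0,1)$. Then for all $k\ge 0$, with $c^k=(1-\gamma)(1-\tau^k)\beta^k$, one has $\widetilde x^k=\frac1{\tau^k}\breve x^k-\frac{1-\tau^k}{\tau^k}\breve x^{k-1}$, $$\frac{1}{\tau^k}[f(x)-f(\breve x^k)]-\frac{1}{\tau^{k-1}}[f(x)-f(\breve x^{k-1})]+(u-\widetilde u^k)^TF(\widetilde u^k)+c^k(A(x-\widetilde x^k))^T(A\breve x^{k-1}-b)\ge (v-\widetilde v^k)^TQ^k(v^k-\widetilde v^k)\quad\forall u,$$ and $v^{k+1}=v^k-M^k(v^k-\widetilde v^k)$. Moreover $Q^k=H^kM^k$, $G^k=(Q^k)^T+Q^k-(M^k)^TH^kM^k$, and with $H_0^k=H^k=\begin{pmatrix}\beta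 D&0\\0&\frac1{\gamma\beta}I_l\end{pmatrix}$ and some $\varTheta^k\ge0$ satisfying $\varTheta^{k+1}-\varTheta^k\ge(1-\gamma)\tau^k\beta^k\|A\widetilde x^k-b\|^2$, $$\|v^{k+1}-v'\|^2_{H^k}-\|v^k-v'\|^2_{H^k}+\|v^k-\widetilde v^k\|^2_{G^k}\ge\|v^{k+1}-v'\|^2_{H_0^{k+1}}-\|v^k-v'\|^2_{H_0^k}+\varTheta^{k+1}-\varTheta^k$$ for all $v'=(x_2',\lambda)$ with $x'=(x_1',x_2')\in\Omega$, $\lambda\in\mathbb{R}^l$. (ii) Suppose $f_2$ is $\sigma$-strongly convex with $\sigma>0$, $\beta^k=\beta/(\tau^k)^2$ with $\beta>0$ and $$\frac1{\tau^k}\Big(\frac{\beta}{\tau^k}+\frac{\sigma}{\sigma_{\max}(D)}\Big)\ge\frac{\beta}{(\tau^{k+1})^2}\quad\text{for all }k\ge 0,$$ and $\tau^k>0$, $1/(\tau^{k-1})^2=(1-\tau^k)/(\tau^k)^2$ for $k\ge0$, $\tau^{-1}\in(0,1)$. Then for all $k\ge0$, with $c^k=(1-\gamma)(1-\tau^k)\beta^k/\tau^k$, $R=D/\sigma_{\max}(D)$, $z=x_2$, $z^k=\widetilde x_2^k$, one has $\widetilde x^k=\frac1{\tau^k}\breve x^k-\frac{1-\tau^k}{\tau^k}\breve x^{k-1}$, $$\frac{1}{(\tau^k)^2}[f(x)-f(\breve x^k)]-\frac{1}{(\tau^{k-1})^2}[f(x)-f(\breve x^{k-1})]+\frac1{\tau^k}(u-\widetilde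 u^k)^TF(\widetilde u^k)+c^k(A(x-\widetilde x^k))^T(A\breve x^{k-1}-b)$$ $$\ge\frac1{\tau^k}\Big[(v-\widetilde v^k)^TQ^k(v^k-\widetilde v^k)+\frac\sigma2\|z^k-z\|_R^2\Big]\quad\forall u,$$ and $v^{k+1}=v^k-M^k(v^k-\widetilde v^k)$. Moreover $Q^k=H^kM^k$, $G^k=(Q^k)^T+Q^k-(M^k)^TH^kM^k$, and with $H_0^k=\frac1{\tau^k}H^k=\begin{pmatrix}\frac{\beta}{(\tau^k)^2}D&0\\0&\frac1{\gamma\beta}I_l\end{pmatrix}$ and some $\varTheta^k\ge0$ satisfying $\varTheta^{k+1}-\varTheta^k\ge(1-\gamma)\beta^k\|A\widetilde x^k-b\|^2$, $$\frac1{\tau^k}\Big(\|v^{k+1}-v'\|^2_{H^k}+\sigma\|z^k-z'\|_R^2-\|v^k-v'\|^2_{H^k}+\|v^k-\widetilde v^k\|^2_{G^k}\Big)\ge\|v^{k+1}-v'\|^2_{H_0^{k+1}}-\|v^k-v'\|^2_{H_0^k}+\varTheta^{k+1}-\varTheta^k$$ for all $v'=(x_2',\lambda)$, $z'=x_2'$, with $x'=(x_1',x_2')\in\Omega$, $\lambda\in\mathbb{R}^l$.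
   Context: Problem (P2): minimize $f(x)=f_1(x_1)+f_2(x_2)$ subject to $Ax:=A_1x_1+A_2x_2=b$, with $f_i:\mathbb{R}^{n_i}\to\mathbb{R}$ closed proper convex, $A_i\in\mathbb{R}^{l\times n_i}$, $b\in\mathbb{R}^l$, $\Omega=\{x:Ax=b\}$; $f_2$ is $\sigma$-strongly convex with $\sigma\ge0$, i.e. $f_2(y)\ge f_2(x)+\langle g,y-x\rangle+\frac\sigma2\|y-x\|^2$ for all $x,y$, $g\in\partial f_2(x)$. $u=(x_1,x_2,\lambda)$, $v=(x_2,\lambda)$, $F(u)=(-A_1^T\lambda,-A_2^T\lambda,Ax-b)$. $\|w\|_D^2:=w^TDw$; $\sigma_{\max}(D)$ is the largest eigenvalue of $D$. Let $\beta^k>0$ and $\varphi^k(x_1,x_2,\lambda):=-\lambda^T(A_1x_1+A_2x_2-b)+\frac{\beta^k}2\|A_1x_1+A_2x_2-b\|^2$. Algorithm 1 (given $x^{-1},x^0,\lambda^0$; the iterates are assumed to be well defined): for $k\ge0$, - $\hat x^k=x^k+\frac{\tau^k(1-\tau^{k-1})}{\tau^{k-1}}(x^k-x^{k-1})$; - $x_1^{k+1}\in\arg\min_{x_1}\{f_1(x_1)+x_1^T\nabla_{x_1}\varphi^k(\hat x_1^k,\hat x_2^k,\lambda^k)+\frac{\beta^k}2\|x_1-\hat x_1^k\|^2_{A_1^TA_1}\}$; - $x_2^{k+1}\in\arg\min_{x_2}\{f_2(x_2)+x_2^T\nabla_{x_2}\varphi^k(x_1^{k+1},\hat x_2^k,\lambda^k)+\frac{\beta^k}2\|x_2-\hat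 x_2^k\|_D^2+\frac{\sigma(1-\tau^k)}{2\tau^k}\|x_2-x_2^k\|^2_{D/\sigma_{\max}(D)}\}$; - $\lambda^{k+1}=\lambda^k$. Derived quantities: $\bar x^{k+1}:=x^{k+1}/\tau^k-(1-\tau^k)x^k/\tau^k$ ($k\ge-1$); $\breve x^k:=x^{k+1}$; $\widetilde x^k:=\bar x^{k+1}$; $\bar\lambda^k:=\lambda^k-\gamma(1-\tau^k)\beta^k(Ax^k-b)$; $\widetilde\lambda^k:=\bar\lambda^k-\tau^k\beta^k(A_1\widetilde x_1^k+A_2\bar x_2^k-b)$. Matrices: $Q^k=\begin{pmatrix}\tau^k\beta^kD&0\\-A_2&\frac1{\tau^k\beta^k}I_l\end{pmatrix}$, $M^k=\begin{pmatrix}I_{n_2}&0\\-\gamma\tau^k\beta^kA_2&\gamma I_l\end{pmatrix}$, $H^k=\begin{pmatrix}\tau^k\beta^kD&0\\0&\frac1{\gamma\tau^k\beta^k}I_l\end{pmatrix}$, $G^k=\begin{pmatrix}\tau^k\beta^k(D-\gamma A_2^TA_2)&-(1-\gamma)A_2^T\\-(1-\gamma)A_2&\frac{2-\gamma}{\tau^k\beta^k}I_l\end{pmatrix}$. *)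

theory Defs
  imports "HOL-Analysis.Analysis"
begin

text \<open>The objective functions are finite-valued, so properness is automatic.\<close>

definition closed_proper_convex :: "('a::euclidean_space \<Rightarrow> real) \<Rightarrow> bool" where
  "closed_proper_convex f \<longleftrightarrow> convex_on UNIV f \<and> closed (epigraph UNIV f)"

definition subdifferential :: "('a::euclidean_space \<Rightarrow> real) \<Rightarrow> 'a \<Rightarrow> 'a set" where
  "subdifferential f x = {g. \<forall>y. f y \<ge> f x + g \<bullet> (y - x)}"

definition strongly_convex :: "real \<Rightarrow> ('a::euclidean_space \<Rightarrow> real) \<Rightarrow> bool" where
  "strongly_convex \<sigma> f \<longleftrightarrow>
     (\<forall>x y. \<forall>g\<in>subdifferential f x. f y \<ge> f x + g \<bullet> (y - x) + \<sigma> / 2 * (norm (y - x))\<^sup>2)"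

definition gradient :: "('a::euclidean_space \<Rightarrow> real) \<Rightarrow> 'a \<Rightarrow> 'a" where
  "gradient f x = (THE g. GDERIV f x :> g)"

definition stack :: "real^'a \<Rightarrow> real^'b \<Rightarrow> real^('a + 'b)" where
  "stack p q = (\<chi> i. case i of Inl a \<Rightarrow> p $ a | Inr b \<Rightarrow> q $ b)"

definition block_matrix ::
  "real^'a^'c \<Rightarrow> real^'b^'c \<Rightarrow> real^'a^'d \<Rightarrow> real^'b^'d \<Rightarrow> real^('a + 'b)^('c + 'd)" where
  "block_matrix P Q R S = (\<chi> i j.
     case i of
       Inl c \<Rightarrow> (case j of Inl a \<Rightarrow> P $ c $ a | Inr b \<Rightarrow> Q $ c $ b)
     | Inr d \<Rightarrow> (case j of Inl a \<Rightarrow> R $ d $ a | Inr b \<Rightarrow> S $ d $ b))"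

definition wnorm2 :: "real^'a^'a \<Rightarrow> real^'a \<Rightarrow> real" where
  "wnorm2 D w = w \<bullet> (D *v w)"

definition eigenvalue :: "real^'a^'a \<Rightarrow> real \<Rightarrow> bool" where
  "eigenvalue D \<mu> \<longleftrightarrow> (\<exists>w. w \<noteq> 0 \<and> D *v w = \<mu> *\<^sub>R w)"

text \<open>Only used for symmetric matrices, for which a largest real eigenvalue exists.\<close>

definition sigma_max :: "real^'a^'a \<Rightarrow> real" where
  "sigma_max D = (GREATEST \<mu>. eigenvalue D \<mu>)"

text \<open>$D/\sigma_{\max}(D)$. For \<open>D = 0\<close> this is the zero matrix, since \<open>inverse 0 = 0\<close>.\<close>

definition normalized_matrix :: "real^'a^'a \<Rightarrow> real^'a^'a" where
  "normalized_matrix D = D /\<^sub>R sigma_max D"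

text \<open>The spectral norm. The library's \<open>norm\<close> on matrices is the Frobenius norm.\<close>

definition spectral_norm :: "real^'a^'b \<Rightarrow> real" where
  "spectral_norm A = onorm ((*v) A)"

definition objective ::
  "(real^'n \<Rightarrow> real) \<Rightarrow> (real^'m \<Rightarrow> real) \<Rightarrow> (real^'n) \<times> (real^'m) \<Rightarrow> real" where
  "objective f1 f2 x = f1 (fst x) + f2 (snd x)"

definition Aop ::
  "real^'n^'l \<Rightarrow> real^'m^'l \<Rightarrow> (real^'n) \<times> (real^'m) \<Rightarrow> real^'l" where
  "Aop A1 A2 x = A1 *v fst x + A2 *v snd x"

definition feasible_set ::
  "real^'n^'l \<Rightarrow> real^'m^'l \<Rightarrow> real^'l \<Rightarrow> ((real^'n) \<times> (real^'m)) set" where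
  "feasible_set A1 A2 b = {x. Aop A1 A2 x = b}"

text \<open>The point $u = (x_1, x_2, \lambda)$ is represented as \<open>((x1, x2), lam)\<close>.\<close>

definition F_op ::
  "real^'n^'l \<Rightarrow> real^'m^'l \<Rightarrow> real^'l \<Rightarrow>
   ((real^'n) \<times> (real^'m)) \<times> (real^'l) \<Rightarrow> ((real^'n) \<times> (real^'m)) \<times> (real^'l)" where
  "F_op A1 A2 b u =
     ((- (transpose A1 *v snd u), - (transpose A2 *v snd u)), Aop A1 A2 (fst u) - b)"

text \<open>
  All sequences are indexed by integers, because \<open>x\<close> and \<open>\<tau>\<close> start at index \<open>-1\<close>.
  Values at smaller indices are never used.
\<close>

definition phi ::
  "real^'n^'l \<Rightarrow> real^'m^'l \<Rightarrow> real^'l \<Rightarrow> real \<Rightarrow> real^'n \<Rightarrow> real^'m \<Rightarrow> real^'l \<Rightarrow> real" where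
  "phi A1 A2 b \<beta>k x1 x2 lam =
     - (lam \<bullet> (A1 *v x1 + A2 *v x2 - b)) + \<beta>k / 2 * (norm (A1 *v x1 + A2 *v x2 - b))\<^sup>2"

definition x_hat ::
  "(int \<Rightarrow> real) \<Rightarrow> (int \<Rightarrow> (real^'n) \<times> (real^'m)) \<Rightarrow> int \<Rightarrow> (real^'n) \<times> (real^'m)" where
  "x_hat \<tau> xs k = xs k + (\<tau> k * (1 - \<tau> (k - 1)) / \<tau> (k - 1)) *\<^sub>R (xs k - xs (k - 1))"

definition algorithm1 ::
  "real^'n^'l \<Rightarrow> real^'m^'l \<Rightarrow> real^'l \<Rightarrow> (real^'n \<Rightarrow> real) \<Rightarrow> (real^'m \<Rightarrow> real) \<Rightarrow>
   real \<Rightarrow> real^'m^'m \<Rightarrow> (int \<Rightarrow> real) \<Rightarrow> (int \<Rightarrow> real) \<Rightarrow>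
   (int \<Rightarrow> (real^'n) \<times> (real^'m)) \<Rightarrow> (int \<Rightarrow> real^'l) \<Rightarrow> bool" where
  "algorithm1 A1 A2 b f1 f2 \<sigma> D \<tau> \<beta>s xs ls \<longleftrightarrow>
     (\<forall>k\<ge>0. let xh = x_hat \<tau> xs k in
        is_arg_min
          (\<lambda>x1. f1 x1
             + x1 \<bullet> gradient (\<lambda>w. phi A1 A2 b (\<beta>s k) w (snd xh) (ls k)) (fst xh)
             + \<beta>s k / 2 * wnorm2 (transpose A1 ** A1) (x1 - fst xh))
          (\<lambda>_. True) (fst (xs (k + 1)))
      \<and> is_arg_min
          (\<lambda>x2. f2 x2
             + x2 \<bullet> gradient (\<lambda>w. phi A1 A2 b (\<beta>s k) (fst (xs (k + 1))) w (ls k)) (snd xh)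
             + \<beta>s k / 2 * wnorm2 D (x2 - snd xh)
             + \<sigma> * (1 - \<tau> k) / (2 * \<tau> k) * wnorm2 (normalized_matrix D) (x2 - snd (xs k)))
          (\<lambda>_. True) (snd (xs (k + 1)))
      \<and> ls (k + 1) = ls k)"

definition x_bar ::
  "(int \<Rightarrow> real) \<Rightarrow> (int \<Rightarrow> (real^'n) \<times> (real^'m)) \<Rightarrow> int \<Rightarrow> (real^'n) \<times> (real^'m)" where
  "x_bar \<tau> xs k = (1 / \<tau> (k - 1)) *\<^sub>R xs k - ((1 - \<tau> (k - 1)) / \<tau> (k - 1)) *\<^sub>R xs (k - 1)"

definition x_breve ::
  "(int \<Rightarrow> (real^'n) \<times> (real^'m)) \<Rightarrow> int \<Rightarrow> (real^'n) \<times> (real^'m)" where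
  "x_breve xs k = xs (k + 1)"

definition x_tilde ::
  "(int \<Rightarrow> real) \<Rightarrow> (int \<Rightarrow> (real^'n) \<times> (real^'m)) \<Rightarrow> int \<Rightarrow> (real^'n) \<times> (real^'m)" where
  "x_tilde \<tau> xs k = x_bar \<tau> xs (k + 1)"

definition lambda_bar ::
  "real^'n^'l \<Rightarrow> real^'m^'l \<Rightarrow> real^'l \<Rightarrow> real \<Rightarrow> (int \<Rightarrow> real) \<Rightarrow> (int \<Rightarrow> real) \<Rightarrow>
   (int \<Rightarrow> (real^'n) \<times> (real^'m)) \<Rightarrow> (int \<Rightarrow> real^'l) \<Rightarrow> int \<Rightarrow> real^'l" where
  "lambda_bar A1 A2 b \<gamma> \<tau> \<beta>s xs ls k =
     ls k - (\<gamma> * (1 - \<tau> k) * \<beta>s k) *\<^sub>R (Aop A1 A2 (xs k) - b)"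

definition lambda_tilde ::
  "real^'n^'l \<Rightarrow> real^'m^'l \<Rightarrow> real^'l \<Rightarrow> real \<Rightarrow> (int \<Rightarrow> real) \<Rightarrow> (int \<Rightarrow> real) \<Rightarrow>
   (int \<Rightarrow> (real^'n) \<times> (real^'m)) \<Rightarrow> (int \<Rightarrow> real^'l) \<Rightarrow> int \<Rightarrow> real^'l" where
  "lambda_tilde A1 A2 b \<gamma> \<tau> \<beta>s xs ls k =
     lambda_bar A1 A2 b \<gamma> \<tau> \<beta>s xs ls k
     - (\<tau> k * \<beta>s k) *\<^sub>R (A1 *v fst (x_tilde \<tau> xs k) + A2 *v snd (x_bar \<tau> xs k) - b)"

definition Q_mat ::
  "real^'m^'l \<Rightarrow> real^'m^'m \<Rightarrow> (int \<Rightarrow> real) \<Rightarrow> (int \<Rightarrow> real) \<Rightarrow> int \<Rightarrow> real^('m + 'l)^('m + 'l)" where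
  "Q_mat A2 D \<tau> \<beta>s k = block_matrix
     ((\<tau> k * \<beta>s k) *\<^sub>R D)  0
     (- A2)               ((1 / (\<tau> k * \<beta>s k)) *\<^sub>R mat 1)"

definition M_mat ::
  "real^'m^'l \<Rightarrow> real \<Rightarrow> (int \<Rightarrow> real) \<Rightarrow> (int \<Rightarrow> real) \<Rightarrow> int \<Rightarrow> real^('m + 'l)^('m + 'l)" where
  "M_mat A2 \<gamma> \<tau> \<beta>s k = block_matrix
     (mat 1)                        0
     ((- (\<gamma> * \<tau> k * \<beta>s k)) *\<^sub>R A2)  (\<gamma> *\<^sub>R mat 1)"

definition H_mat ::
  "real^'m^'m \<Rightarrow> real \<Rightarrow> (int \<Rightarrow> real) \<Rightarrow> (int \<Rightarrow> real) \<Rightarrow> int \<Rightarrow>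
   real^('m + 'l::finite)^('m + 'l)" where
  "H_mat D \<gamma> \<tau> \<beta>s k = block_matrix
     ((\<tau> k * \<beta>s k) *\<^sub>R D)  0
     0                    ((1 / (\<gamma> * \<tau> k * \<beta>s k)) *\<^sub>R mat 1)"

definition G_mat ::
  "real^'m^'l \<Rightarrow> real^'m^'m \<Rightarrow> real \<Rightarrow> (int \<Rightarrow> real) \<Rightarrow> (int \<Rightarrow> real) \<Rightarrow> int \<Rightarrow>
   real^('m + 'l)^('m + 'l)" where
  "G_mat A2 D \<gamma> \<tau> \<beta>s k = block_matrix
     ((\<tau> k * \<beta>s k) *\<^sub>R (D - \<gamma> *\<^sub>R (transpose A2 ** A2)))  ((- (1 - \<gamma>)) *\<^sub>R transpose A2)
     ((- (1 - \<gamma>)) *\<^sub>R A2)                           (((2 - \<gamma>) / (\<tau> k * \<beta>s k)) *\<^sub>R mat 1)"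

end

theory Submission
  imports Defs
begin

text \<open>
  Both subproblems have optimality conditions with the same extrapolated multiplier
  \<open>\<lambda>\<^sup>k - \<beta>\<^sup>k (A\<^sub>1 x\<^sub>1\<^sup>k\<^sup>+\<^sup>1 + A\<^sub>2 x\<^sub>2 - b)\<close>, where \<open>x\<^sub>2\<close> is the extrapolated second block. Since
  \<open>x\<^sup>k\<^sup>+\<^sup>1\<close> is the convex combination of \<open>x\<^sup>k\<close> and \<open>x_tilde\<close> with weights \<open>1 - \<tau>\<^sup>k\<close> and
  \<open>\<tau>\<^sup>k\<close>, averaging the subgradient inequalities at \<open>x\<close> and at \<open>x\<^sup>k\<close> with these weights gives
  one prediction inequality, from which both regimes follow by rescaling. The update of
  \<open>lambda_bar\<close> only needs \<open>(1 - \<tau>\<^sup>k\<^sup>+\<^sup>1) \<beta>\<^sup>k\<^sup>+\<^sup>1 = \<beta>\<^sup>k\<close>. Finally, with \<open>s = A x_tilde - b\<close>,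
  \<open>d\<close> the first block of \<open>v - v_tilde\<close> and \<open>t = A\<^sub>2 d\<close>, the \<open>G\<close>-form of \<open>v - v_tilde\<close>
  divided by \<open>\<tau> \<beta>\<close> equals \<open>(1 - \<gamma>) |s|\<^sup>2 + |s + t|\<^sup>2 + (d \<bullet> D d - |t|\<^sup>2)\<close>, and \<open>\<Theta>\<close> sums up the
  first of these nonnegative terms.
\<close>

section \<open>Calculus of block vectors and block matrices\<close>

lemma sum_UNIV_Plus:
  fixes h :: "'a::finite + 'b::finite \<Rightarrow> 'c::comm_monoid_add"
  shows "(\<Sum>i\<in>UNIV. h i) = (\<Sum>a\<in>UNIV. h (Inl a)) + (\<Sum>c\<in>UNIV. h (Inr c))"
  by (simp add: UNIV_Plus_UNIV[symmetric] sum.Plus del: UNIV_Plus_UNIV)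

lemma stack_diff: "stack p q - stack r s = stack (p - r) (q - s)"
  by (simp add: stack_def vec_eq_iff split: sum.split)

lemma inner_stack: "stack p q \<bullet> stack r s = p \<bullet> r + q \<bullet> s"
  by (simp add: inner_vec_def sum_UNIV_Plus stack_def)

lemma block_matrix_mult_stack:
  "block_matrix P Q R S *v stack p q = stack (P *v p + Q *v q) (R *v p + S *v q)"
  by (simp add: vec_eq_iff matrix_vector_mult_def sum_UNIV_Plus stack_def block_matrix_def
      split: sum.split)

lemma block_matrix_mult:
  "block_matrix P Q R S ** block_matrix P' Q' R' S' =
   block_matrix (P ** P' + Q ** R') (P ** Q' + Q ** S') (R ** P' + S ** R') (R ** Q' + S ** S')"
  by (simp add: vec_eq_iff matrix_matrix_mult_def sum_UNIV_Plus block_matrix_def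
      split: sum.split)

lemma transpose_block_matrix:
  "transpose (block_matrix P Q R S) =
   block_matrix (transpose P) (transpose R) (transpose Q) (transpose S)"
  by (simp add: vec_eq_iff transpose_def block_matrix_def split: sum.split)

lemma block_matrix_add:
  "block_matrix P Q R S + block_matrix P' Q' R' S' =
   block_matrix (P + P') (Q + Q') (R + R') (S + S')"
  by (simp add: vec_eq_iff block_matrix_def split: sum.split)

lemma block_matrix_diff:
  "block_matrix P Q R S - block_matrix P' Q' R' S' =
   block_matrix (P - P') (Q - Q') (R - R') (S - S')"
  by (simp add: vec_eq_iff block_matrix_def split: sum.split)

lemma block_matrix_scaleR:
  "c *\<^sub>R block_matrix P Q R S = block_matrix (c *\<^sub>R P) (c *\<^sub>R Q) (c *\<^sub>R R) (c *\<^sub>R S)"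
  by (simp add: vec_eq_iff block_matrix_def split: sum.split)

lemma uminus_matrix_vector_mult: "(- P) *v x = - (P *v x)" for P :: "real^'a^'b"
  by (simp add: vec_eq_iff matrix_vector_mult_def sum_negf)

lemma uminus_matrix_mult: "(- P) ** S = - (P ** S)" for P :: "real^'a^'b"
  by (simp add: vec_eq_iff matrix_matrix_mult_def sum_negf)

lemma matrix_mult_uminus: "P ** (- S) = - (P ** S)" for P :: "real^'a^'b"
  by (simp add: vec_eq_iff matrix_matrix_mult_def sum_negf)

lemma transpose_uminus: "transpose (- P) = - transpose P" for P :: "real^'a^'b"
  by (simp add: vec_eq_iff transpose_def)

lemma transpose_zero: "transpose 0 = (0 :: real^'a^'b)"
  by (simp add: vec_eq_iff transpose_def)

section \<open>Quadratic forms and the largest eigenvalue of a symmetric matrix\<close>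

lemma inner_transpose_mult: "(transpose A *v y) \<bullet> x = y \<bullet> (A *v x)"
  for A :: "real^'a^'b"
  by (simp add: dot_lmul_matrix)

lemma inner_mult_symmetric:
  fixes D :: "real^'a^'a"
  assumes "transpose D = D"
  shows "v \<bullet> (D *v w) = w \<bullet> (D *v v)"
  using inner_transpose_mult[of D v w] assms by (simp add: inner_commute)

text \<open>Symmetry merges the two cross terms, so the form is an exact quadratic polynomial in
  \<open>t\<close> along every line.\<close>

lemma wnorm2_add_scaleR:
  assumes "transpose S = S"
  shows "wnorm2 S (v + t *\<^sub>R d) = wnorm2 S v + 2 * t * ((S *v v) \<bullet> d) + t\<^sup>2 * wnorm2 S d"
  using inner_mult_symmetric[OF assms, of v d]
  by (simp add: wnorm2_def matrix_vector_right_distrib matrix_vector_mult_scaleR inner_simps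
      power2_eq_square inner_commute algebra_simps)

lemma wnorm2_scaleR_mat: "wnorm2 (c *\<^sub>R D) w = c * wnorm2 D w"
  by (simp add: wnorm2_def scaleR_matrix_vector_assoc[symmetric])

text \<open>Dividing by \<open>t\<close> and letting \<open>t\<close> tend to 0 leaves
  \<open>a\<close>. This extracts first-order conditions from minimality without differentiating the
  convex function.\<close>

lemma nonneg_of_nonneg_quadratic:
  fixes a k :: real
  assumes "\<And>t. 0 < t \<Longrightarrow> t \<le> 1 \<Longrightarrow> 0 \<le> t * a + t\<^sup>2 * k"
  shows "0 \<le> a"
proof (rule ccontr)
  assume "\<not> 0 \<le> a"
  \<comment> \<open>This bound makes \<open>t * (\<bar>k\<bar> + 1)\<close> at most half of
    \<open>- a\<close>, so the quadratic term cannot offset the negative linear one.\<close>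
  define t where "t = min 1 (- a / (2 * (\<bar>k\<bar> + 1)))"
  have t: "0 < t" "t \<le> 1" using \<open>\<not> 0 \<le> a\<close> by (auto simp: t_def intro!: divide_neg_pos)
  have "t * (2 * (\<bar>k\<bar> + 1)) \<le> - a"
    using min.cobounded2[of 1 "- a / (2 * (\<bar>k\<bar> + 1))"]
    unfolding t_def[symmetric] by (subst (asm) pos_le_divide_eq) auto
  moreover have "t * k \<le> t * (\<bar>k\<bar> + 1)" using t by (intro mult_left_mono) auto
  moreover have "t * (\<bar>k\<bar> + 1) > 0" using t by (intro mult_pos_pos) auto
  ultimately have "a + t * k < 0" by (simp add: algebra_simps)
  then have "t * (a + t * k) < 0" using t by (simp add: mult_pos_neg)
  with assms[OF t] show False by (simp add: power2_eq_square algebra_simps)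
qed

text \<open>Such a \<open>w\<close> minimizes the form. Moving from \<open>w\<close> by
  \<open>t / 2\<close> along \<open>- (S *v w)\<close> changes it to first order by
  \<open>- t\<close> times the squared norm of \<open>S *v w\<close>, which must therefore
  vanish.\<close>

lemma psd_wnorm2_eq_0:
  assumes sym: "transpose S = S" and psd: "\<And>w. 0 \<le> wnorm2 S w" and "wnorm2 S w = 0"
  shows "S *v w = 0"
proof -
  have "0 \<le> - ((S *v w) \<bullet> (S *v w))"
  proof (rule nonneg_of_nonneg_quadratic)
    fix t :: real
    show "0 \<le> t * - ((S *v w) \<bullet> (S *v w)) + t\<^sup>2 * (wnorm2 S (S *v w) / 4)"
      using psd[of "w + (- t / 2) *\<^sub>R (S *v w)"] assms(3)
      unfolding wnorm2_add_scaleR[OF sym] by (simp add: power2_eq_square)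
  qed
  then show ?thesis by (metis inner_eq_zero_iff inner_ge_zero neg_0_le_iff_le order_antisym)
qed

text \<open>A unit vector maximizing the Rayleigh quotient is an eigenvector, being a zero of the positive
  semidefinite form of \<open>\<mu> I - D\<close>. Hence the \<open>GREATEST\<close> in \<open>sigma_max\<close> is attained.\<close>

lemma wnorm2_le_sigma_max:
  fixes D :: "real^'a^'a"
  assumes sym: "transpose D = D"
  shows "wnorm2 D w \<le> sigma_max D * (norm w)\<^sup>2"
proof -
  have "continuous_on (sphere 0 1) (wnorm2 D)"
    unfolding wnorm2_def by (intro continuous_intros)
  moreover have "sphere (0::real^'a) 1 \<noteq> {}" by simp
  ultimately have "\<exists>w0\<in>sphere 0 1. \<forall>w\<in>sphere 0 1. wnorm2 D w \<le> wnorm2 D w0"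
    by (intro continuous_attains_sup compact_sphere)
  then obtain w0 where w0: "norm w0 = 1"
    and max: "\<And>w. norm w = 1 \<Longrightarrow> wnorm2 D w \<le> wnorm2 D w0"
    by auto
  define \<mu> where "\<mu> = wnorm2 D w0"
  have le: "wnorm2 D w \<le> \<mu> * (norm w)\<^sup>2" for w
  proof (cases "w = 0")
    case False
    then have "wnorm2 D (w /\<^sub>R norm w) \<le> \<mu>"
      unfolding \<mu>_def by (intro max) simp
    moreover have "wnorm2 D (w /\<^sub>R norm w) = wnorm2 D w / (norm w)\<^sup>2"
      by (simp add: wnorm2_def matrix_vector_mult_scaleR power2_eq_square field_simps)
    ultimately have "wnorm2 D w / (norm w)\<^sup>2 \<le> \<mu>" by simp
    then show ?thesis using False by (simp add: pos_divide_le_eq)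
  qed (simp add: wnorm2_def)
  let ?S = "\<mu> *\<^sub>R mat 1 - D"
  have S: "wnorm2 ?S w = \<mu> * (norm w)\<^sup>2 - wnorm2 D w" for w
    by (simp add: wnorm2_def matrix_vector_mult_diff_rdistrib scaleR_matrix_vector_assoc[symmetric]
        inner_diff_right power2_norm_eq_inner)
  have "transpose ?S = ?S"
    using sym by (simp add: vec_eq_iff transpose_def mat_def)
  moreover have "0 \<le> wnorm2 ?S w" for w using le[of w] S[of w] by simp
  moreover have "wnorm2 ?S w0 = 0" unfolding S by (simp add: w0 \<mu>_def)
  ultimately have "?S *v w0 = 0" by (rule psd_wnorm2_eq_0)
  then have ev: "eigenvalue D \<mu>"
    unfolding eigenvalue_def using w0
    by (intro exI[of _ w0])
      (auto simp: matrix_vector_mult_diff_rdistrib scaleR_matrix_vector_assoc[symmetric])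
  \<comment> \<open>An eigenvalue is the Rayleigh quotient of its eigenvector, hence at most the
    maximum \<mu>.\<close>
  have "\<nu> \<le> \<mu>" if \<nu>: "eigenvalue D \<nu>" for \<nu>
  proof -
    obtain u where "u \<noteq> 0" "D *v u = \<nu> *\<^sub>R u" using \<nu> by (auto simp: eigenvalue_def)
    with le[of u] show ?thesis by (simp add: wnorm2_def power2_norm_eq_inner)
  qed
  with ev have "sigma_max D = \<mu>"
    unfolding sigma_max_def by (intro Greatest_equality) auto
  with le show ?thesis by simp
qed

lemma wnorm2_normalized_matrix: "wnorm2 (normalized_matrix D) w = wnorm2 D w / sigma_max D"
  by (simp add: normalized_matrix_def wnorm2_scaleR_mat divide_inverse mult.commute)

text \<open>Divide the Rayleigh bound by \<open>sigma_max D\<close>. If that is 0, the normalized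
  form is 0 as well and both bounds persist. They allow the Euclidean gain of strong convexity to
  dominate the weighted proximal term.\<close>

lemma wnorm2_normalized_matrix_bounds:
  assumes sym: "transpose D = D" and psd: "\<And>w. 0 \<le> wnorm2 D w"
  shows "0 \<le> wnorm2 (normalized_matrix D) w" and "wnorm2 (normalized_matrix D) w \<le> (norm w)\<^sup>2"
proof -
  have le: "wnorm2 D w \<le> sigma_max D * (norm w)\<^sup>2" for w
    by (rule wnorm2_le_sigma_max[OF sym])
  \<comment> \<open>Any unit vector serves here; a coordinate vector is at hand.\<close>
  have "0 \<le> sigma_max D"
    using order_trans[OF psd le, of "axis undefined 1"] by simp
  with psd[of w] le[of w] show "0 \<le> wnorm2 (normalized_matrix D) w"
    "wnorm2 (normalized_matrix D) w \<le> (norm w)\<^sup>2"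
    unfolding wnorm2_normalized_matrix by (auto simp: divide_le_eq mult.commute)
qed

section \<open>The two choices of the proximal matrix \<open>D\<close>\<close>

lemma preconditioner_symmetric:
  assumes "D = transpose A ** A \<or> D = (spectral_norm A)\<^sup>2 *\<^sub>R mat 1"
  shows "transpose D = D"
  using assms by (auto simp: matrix_transpose_mul transpose_scalar)

text \<open>Equality for the Gram matrix, the operator norm bound for the scaled identity. With
  symmetry, this lets both choices of \<open>D\<close> be treated alike.\<close>

lemma preconditioner_ge:
  fixes A :: "real^'m^'l"
  assumes "D = transpose A ** A \<or> D = (spectral_norm A)\<^sup>2 *\<^sub>R mat 1"
  shows "(norm (A *v w))\<^sup>2 \<le> wnorm2 D w"
  using assms
proof
  assume "D = transpose A ** A"
  then show ?thesis
    using inner_transpose_mult[of A "A *v w" w]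
    by (simp add: wnorm2_def matrix_vector_mul_assoc[symmetric] power2_norm_eq_inner inner_commute)
next
  assume D: "D = (spectral_norm A)\<^sup>2 *\<^sub>R mat 1"
  have "norm (A *v w) \<le> spectral_norm A * norm w"
    unfolding spectral_norm_def by (rule onorm) (rule matrix_vector_mul_bounded_linear)
  then have "(norm (A *v w))\<^sup>2 \<le> (spectral_norm A * norm w)\<^sup>2" by (intro power_mono) auto
  then show ?thesis
    by (simp add: D wnorm2_scaleR_mat power_mult_distrib) (simp add: wnorm2_def power2_norm_eq_inner)
qed

section \<open>Optimality conditions and averaged subgradient inequalities\<close>

lemma gradientI: "GDERIV f x :> g \<Longrightarrow> gradient f x = g"
proof -
  assume g: "GDERIV f x :> g"
  have "g' = g" if "GDERIV f x :> g'" for g'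
  proof -
    have "(\<lambda>h. h \<bullet> g') = (\<lambda>h. h \<bullet> g)"
      using that g unfolding gderiv_def by (rule has_derivative_unique)
    then have "\<forall>h. h \<bullet> g' = h \<bullet> g" by (auto dest: fun_cong)
    then show ?thesis by (rule vector_eq_ldot[THEN iffD1])
  qed
  with g show ?thesis unfolding gradient_def by (rule the_equality)
qed

text \<open>The offset \<open>d\<close> absorbs the block held fixed, so both partial gradients of
  \<open>phi\<close> are instances.\<close>

lemma gradient_affine_quadratic:
  fixes A :: "real^'a^'l"
  shows "gradient (\<lambda>w. - (lam \<bullet> (A *v w + d)) + c / 2 * (norm (A *v w + d))\<^sup>2) x
    = transpose A *v (c *\<^sub>R (A *v x + d) - lam)"
proof (rule gradientI, unfold gderiv_def power2_norm_eq_inner)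
  have A: "((*v) A has_derivative (*v) A) (at x)"
    by (intro bounded_linear_imp_has_derivative) (rule matrix_vector_mul_bounded_linear)
  have eq: "h \<bullet> (transpose A *v y) = y \<bullet> (A *v h)" for h y
    using inner_transpose_mult[of A y h] by (simp add: inner_commute)
  let ?r = "\<lambda>w. A *v w + d"
  have r: "(?r has_derivative (\<lambda>h. A *v h)) (at x)"
    by (rule has_derivative_add_const[OF A])
  have "((\<lambda>w. - (lam \<bullet> ?r w) + c / 2 * (?r w \<bullet> ?r w)) has_derivative
    (\<lambda>h. - (lam \<bullet> (A *v h)) + c / 2 * (?r x \<bullet> (A *v h) + (A *v h) \<bullet> ?r x))) (at x)"
    by (intro has_derivative_add has_derivative_minus has_derivative_mult_right
        has_derivative_inner_right has_derivative_inner r)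
  moreover have "- (lam \<bullet> (A *v h)) + c / 2 * (?r x \<bullet> (A *v h) + (A *v h) \<bullet> ?r x)
      = (c *\<^sub>R ?r x - lam) \<bullet> (A *v h)" for h
    unfolding inner_commute[of "A *v h" "?r x"] by (simp add: inner_diff_left)
  ultimately show "((\<lambda>w. - (lam \<bullet> ?r w) + c / 2 * (?r w \<bullet> ?r w)) has_derivative
    (\<lambda>h. h \<bullet> (transpose A *v (c *\<^sub>R ?r x - lam)))) (at x)"
    unfolding eq by simp
qed

text \<open>Compare the minimizer \<open>x\<close> with points on the segment to \<open>y\<close>.
  Convexity bounds \<open>f\<close> there by an affine function of \<open>t\<close> and the other
  terms are exact quadratics, so the coefficient of \<open>t\<close> in the difference is
  nonnegative; this is the subgradient inequality.\<close>

lemma argmin_subgradient: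
  assumes conv: "convex_on UNIV f" and P: "transpose P = P" and S: "transpose S = S"
    and min: "is_arg_min (\<lambda>w. f w + w \<bullet> g + \<alpha> / 2 * wnorm2 P (w - c) + \<delta> * wnorm2 S (w - e))
      (\<lambda>_. True) x"
  shows "- (g + \<alpha> *\<^sub>R (P *v (x - c)) + (2 * \<delta>) *\<^sub>R (S *v (x - e))) \<in> subdifferential f x"
  unfolding subdifferential_def
proof (intro CollectI allI)
  fix y
  let ?d = "y - x"
  let ?G = "g + \<alpha> *\<^sub>R (P *v (x - c)) + (2 * \<delta>) *\<^sub>R (S *v (x - e))"
  have "0 \<le> f y - f x + ?G \<bullet> ?d"
  proof (rule nonneg_of_nonneg_quadratic)
    fix t :: real assume t: "0 < t" "t \<le> 1"
    have shift: "x + t *\<^sub>R ?d - c = (x - c) + t *\<^sub>R ?d" for c by simp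
    have "f x + x \<bullet> g + \<alpha> / 2 * wnorm2 P (x - c) + \<delta> * wnorm2 S (x - e)
      \<le> f (x + t *\<^sub>R ?d) + (x + t *\<^sub>R ?d) \<bullet> g + \<alpha> / 2 * wnorm2 P (x + t *\<^sub>R ?d - c)
        + \<delta> * wnorm2 S (x + t *\<^sub>R ?d - e)"
      using min by (auto simp: is_arg_min_linorder)
    moreover have "f (x + t *\<^sub>R ?d) \<le> (1 - t) * f x + t * f y"
      using convex_onD[OF conv, of t x y] t by (simp add: algebra_simps)
    moreover have "(x + t *\<^sub>R ?d) \<bullet> g = x \<bullet> g + t * (g \<bullet> ?d)"
      by (simp add: inner_add_left inner_commute[of ?d g])
    ultimately show "0 \<le> t * (f y - f x + ?G \<bullet> ?d)
        + t\<^sup>2 * (\<alpha> / 2 * wnorm2 P ?d + \<delta> * wnorm2 S ?d)"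
      unfolding shift wnorm2_add_scaleR[OF P] wnorm2_add_scaleR[OF S]
      by (simp add: inner_add_left algebra_simps del: inner_diff_right)
  qed
  then show "f x + - ?G \<bullet> (y - x) \<le> f y" unfolding inner_minus_left by linarith
qed

text \<open>The inequality at \<open>p\<close> is tested at \<open>x\<close> with weight
  \<open>t\<close> and at \<open>x0\<close> with weight \<open>1 - t\<close>. The linear parts
  collapse because \<open>t *\<^sub>R (x - p) + (1 - t) *\<^sub>R (x0 - p) = t *\<^sub>R (x -
  xt)\<close>; division by \<open>t\<close> finishes.\<close>

lemma subgradient_combination:
  assumes sub: "\<And>y. f p + g \<bullet> (y - p) + s / 2 * (norm (y - p))\<^sup>2 \<le> f y"
    and t: "0 < t" "t \<le> 1" and p: "p = (1 - t) *\<^sub>R x0 + t *\<^sub>R xt"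
  shows "g \<bullet> (x - xt) + s / 2 * ((norm (x - p))\<^sup>2 + (1 - t) / t * (norm (x0 - p))\<^sup>2)
    \<le> 1 / t * (f x - f p) - (1 - t) / t * (f x - f x0)"
proof -
  have "t * (f p + g \<bullet> (x - p) + s / 2 * (norm (x - p))\<^sup>2)
      + (1 - t) * (f p + g \<bullet> (x0 - p) + s / 2 * (norm (x0 - p))\<^sup>2) \<le> t * f x + (1 - t) * f x0"
    using sub t by (intro add_mono mult_left_mono) auto
  moreover have "t * (g \<bullet> (x - p)) + (1 - t) * (g \<bullet> (x0 - p)) = t * (g \<bullet> (x - xt))"
    unfolding p by (simp add: inner_simps algebra_simps)
  ultimately have "t * (g \<bullet> (x - xt)) + s / 2 * (t * (norm (x - p))\<^sup>2 + (1 - t) * (norm (x0 - p))\<^sup>2)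
      \<le> (f x - f p) - (1 - t) * (f x - f x0)"
    by (simp add: algebra_simps add_divide_distrib diff_divide_distrib)
  then have "(t * (g \<bullet> (x - xt)) + s / 2 * (t * (norm (x - p))\<^sup>2 + (1 - t) * (norm (x0 - p))\<^sup>2)) / t
      \<le> ((f x - f p) - (1 - t) * (f x - f x0)) / t"
    using t by (intro divide_right_mono) auto
  moreover have "(t * (g \<bullet> (x - xt)) + s / 2 * (t * (norm (x - p))\<^sup>2 + (1 - t) * (norm (x0 - p))\<^sup>2)) / t
      = g \<bullet> (x - xt) + s / 2 * ((norm (x - p))\<^sup>2 + (1 - t) / t * (norm (x0 - p))\<^sup>2)"
    using t by (simp add: add_divide_distrib distrib_left)
  moreover have "((f x - f p) - (1 - t) * (f x - f x0)) / t
      = 1 / t * (f x - f p) - (1 - t) / t * (f x - f x0)"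
    by (simp only: times_divide_eq_left mult_1 diff_divide_distrib[of "f x - f p"])
  ultimately show ?thesis by (simp only:)
qed

section \<open>Setting common to both regimes and relations between the iterates\<close>

locale primal_dual_iterates =
  fixes f1 :: "real^'n \<Rightarrow> real" and f2 :: "real^'m \<Rightarrow> real"
    and A1 :: "real^'n^'l" and A2 :: "real^'m^'l" and b :: "real^'l"
    and D :: "real^'m^'m" and \<gamma> \<sigma> :: real
    and \<tau> \<beta>s :: "int \<Rightarrow> real"
    and xs :: "int \<Rightarrow> (real^'n) \<times> (real^'m)" and ls :: "int \<Rightarrow> real^'l"
  assumes convex_f1: "convex_on UNIV f1" and convex_f2: "convex_on UNIV f2"
    and sigma_nonneg: "\<sigma> \<ge> 0" and strongly_convex_f2: "strongly_convex \<sigma> f2"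
    and gamma_pos: "0 < \<gamma>" and gamma_le_1: "\<gamma> \<le> 1"
    and D_cases: "D = transpose A2 ** A2 \<or> D = (spectral_norm A2)\<^sup>2 *\<^sub>R mat 1"
    and beta_pos: "k \<ge> 0 \<Longrightarrow> \<beta>s k > 0"
    and algorithm: "algorithm1 A1 A2 b f1 f2 \<sigma> D \<tau> \<beta>s xs ls"
    and tau_pos: "k \<ge> -1 \<Longrightarrow> 0 < \<tau> k" and tau_le_1: "k \<ge> 0 \<Longrightarrow> \<tau> k \<le> 1"
    and beta_step: "k \<ge> 0 \<Longrightarrow> (1 - \<tau> (k + 1)) * \<beta>s (k + 1) = \<beta>s k"
begin

abbreviation "f \<equiv> objective f1 f2"
abbreviation "A \<equiv> Aop A1 A2"
abbreviation "F \<equiv> F_op A1 A2 b"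
abbreviation "xt \<equiv> x_tilde \<tau> xs"
abbreviation "xb \<equiv> x_bar \<tau> xs"
abbreviation "lb \<equiv> lambda_bar A1 A2 b \<gamma> \<tau> \<beta>s xs ls"
abbreviation "lt \<equiv> lambda_tilde A1 A2 b \<gamma> \<tau> \<beta>s xs ls"
abbreviation "v k \<equiv> stack (snd (xb k)) (lb k)"
abbreviation "vt k \<equiv> stack (snd (xt k)) (lt k)"
abbreviation "Q \<equiv> Q_mat A2 D \<tau> \<beta>s"
abbreviation "M \<equiv> M_mat A2 \<gamma> \<tau> \<beta>s"
abbreviation "H \<equiv> H_mat D \<gamma> \<tau> \<beta>s :: int \<Rightarrow> real^('m + 'l)^('m + 'l)"
abbreviation "G \<equiv> G_mat A2 D \<gamma> \<tau> \<beta>s"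
abbreviation "R \<equiv> normalized_matrix D"

lemma D_symmetric: "transpose D = D"
  using D_cases by (rule preconditioner_symmetric)

lemma D_ge: "(norm (A2 *v w))\<^sup>2 \<le> wnorm2 D w"
  using D_cases by (rule preconditioner_ge)

lemma D_psd: "0 \<le> wnorm2 D w"
  using D_ge[of w] by (rule order_trans[rotated]) simp

lemma R_symmetric: "transpose R = R"
  by (simp add: normalized_matrix_def transpose_scalar D_symmetric)

lemmas R_bounds = wnorm2_normalized_matrix_bounds[OF D_symmetric D_psd]

lemma multiplier_const: "k \<ge> 0 \<Longrightarrow> ls (k + 1) = ls k"
  using algorithm by (simp add: algorithm1_def Let_def)

lemma x_next: "k \<ge> 0 \<Longrightarrow> xs (k + 1) = (1 - \<tau> k) *\<^sub>R xs k + \<tau> k *\<^sub>R xt k"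
  using tau_pos[of k] by (simp add: x_tilde_def x_bar_def scaleR_diff_right)

text \<open>The extrapolation has the same weights as \<open>x_next\<close>, with \<open>xb\<close>
  in place of \<open>xt\<close>. Hence new minus extrapolated point is
  \<open>\<tau> k *\<^sub>R (xt k - xb k)\<close>, which turns the proximal term into one in
  \<open>v k - vt k\<close>.\<close>

lemma x_hat_eq: "k \<ge> 0 \<Longrightarrow> x_hat \<tau> xs k = (1 - \<tau> k) *\<^sub>R xs k + \<tau> k *\<^sub>R xb k"
  using tau_pos[of "k - 1"]
  by (simp add: x_hat_def x_bar_def scaleR_diff_right scaleR_diff_left diff_divide_distrib
      right_diff_distrib)

lemma xt_eq: "xt k = (1 / \<tau> k) *\<^sub>R xs (k + 1) - ((1 - \<tau> k) / \<tau> k) *\<^sub>R xs k"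
  by (simp add: x_tilde_def x_bar_def)

lemma A_next: "k \<ge> 0 \<Longrightarrow>
    A (xs (k + 1)) - b = (1 - \<tau> k) *\<^sub>R (A (xs k) - b) + \<tau> k *\<^sub>R (A (xt k) - b)"
  unfolding x_next
  by (simp add: Aop_def matrix_vector_right_distrib matrix_vector_mult_scaleR algebra_simps)

text \<open>\<open>lt\<close> is built from the new first but the old second block; passing to the
  new second block leaves the \<open>A2\<close> term.\<close>

lemma lb_minus_lt: "lb k - lt k = (\<tau> k * \<beta>s k) *\<^sub>R
    ((A (xt k) - b) + A2 *v (snd (xb k) - snd (xt k)))"
  by (simp add: lambda_tilde_def Aop_def matrix_vector_mult_diff_distrib algebra_simps)

text \<open>The multiplier of the optimality conditions, written relative to \<open>lt\<close>
  because the prediction inequality is; the difference produces the term with coefficient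
  \<open>c\<close>.\<close>

definition multiplier :: "int \<Rightarrow> real^'l" where
  "multiplier k = lt k - ((1 - \<gamma>) * (1 - \<tau> k) * \<beta>s k) *\<^sub>R (A (xs k) - b)"

text \<open>The share \<gamma> of the old residual inside \<open>lb\<close> and the share
  \<open>1 - \<gamma>\<close> subtracted here add up to the full weight
  \<open>(1 - \<tau> k) * \<beta>s k\<close>; the two convex combinations then merge the
  residuals.\<close>

lemma multiplier_eq:
  assumes "k \<ge> 0"
  shows "multiplier k =
    ls k - \<beta>s k *\<^sub>R (A1 *v fst (xs (k + 1)) + A2 *v snd (x_hat \<tau> xs k) - b)"
  unfolding multiplier_def x_next[OF assms] x_hat_eq[OF assms]
  by (simp add: lambda_tilde_def lambda_bar_def Aop_def
      matrix_vector_right_distrib matrix_vector_mult_scaleR algebra_simps)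

section \<open>Subgradients at the new iterate and the prediction inequality\<close>

lemma subgradient_f1:
  assumes k: "k \<ge> 0"
  shows "transpose A1 *v multiplier k \<in> subdifferential f1 (fst (xs (k + 1)))"
proof -
  let ?xh = "x_hat \<tau> xs k" and ?x = "fst (xs (k + 1))"
  let ?g = "gradient (\<lambda>w. phi A1 A2 b (\<beta>s k) w (snd ?xh) (ls k)) (fst ?xh)"
  have "(\<lambda>w. phi A1 A2 b (\<beta>s k) w (snd ?xh) (ls k)) = (\<lambda>w. - (ls k \<bullet> (A1 *v w + (A2 *v snd ?xh - b)))
      + \<beta>s k / 2 * (norm (A1 *v w + (A2 *v snd ?xh - b)))\<^sup>2)"
    by (simp add: phi_def add_diff_eq)
  then have g: "?g = transpose A1 *v (\<beta>s k *\<^sub>R (A1 *v fst ?xh + (A2 *v snd ?xh - b)) - ls k)"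
    by (simp only: gradient_affine_quadratic)
  \<comment> \<open>The second quadratic of \<open>argmin_subgradient\<close> is filled with
    zeros.\<close>
  have min: "is_arg_min (\<lambda>w. f1 w + w \<bullet> ?g + \<beta>s k / 2 * wnorm2 (transpose A1 ** A1) (w - fst ?xh)
      + 0 * wnorm2 0 (w - 0)) (\<lambda>_. True) ?x"
    using algorithm k by (simp add: algorithm1_def Let_def)
  have sym: "transpose (transpose A1 ** A1) = transpose A1 ** A1"
    by (simp add: matrix_transpose_mul)
  have "- (?g + \<beta>s k *\<^sub>R ((transpose A1 ** A1) *v (?x - fst ?xh)) + (2 * 0) *\<^sub>R (0 *v (?x - 0)))
      \<in> subdifferential f1 ?x"
    by (rule argmin_subgradient[OF convex_f1 sym _ min]) (simp add: transpose_def vec_eq_iff)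
  \<comment> \<open>The proximal term replaces the extrapolated first block inside the gradient by
    the new one.\<close>
  moreover have "- (?g + \<beta>s k *\<^sub>R ((transpose A1 ** A1) *v (?x - fst ?xh)) + (2 * 0) *\<^sub>R (0 *v (?x - 0)))
      = transpose A1 *v multiplier k"
    unfolding g multiplier_eq[OF k]
    by (simp add: matrix_vector_mul_assoc[symmetric] matrix_vector_mult_diff_distrib
        matrix_vector_right_distrib matrix_vector_mult_scaleR algebra_simps
        del: transpose_matrix_vector)
  ultimately show ?thesis by simp
qed

lemma subgradient_f2:
  assumes k: "k \<ge> 0"
  shows "transpose A2 *v multiplier k - (\<tau> k * \<beta>s k) *\<^sub>R (D *v (snd (xt k) - snd (xb k)))
      - (\<sigma> * (1 - \<tau> k) / \<tau> k) *\<^sub>R (R *v (snd (xs (k + 1)) - snd (xs k)))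
    \<in> subdifferential f2 (snd (xs (k + 1)))"
proof -
  let ?xh = "x_hat \<tau> xs k" and ?x = "snd (xs (k + 1))" and ?x1 = "fst (xs (k + 1))"
  let ?g = "gradient (\<lambda>w. phi A1 A2 b (\<beta>s k) ?x1 w (ls k)) (snd ?xh)"
  let ?s = "\<sigma> * (1 - \<tau> k) / (2 * \<tau> k)"
  have "(\<lambda>w. phi A1 A2 b (\<beta>s k) ?x1 w (ls k)) = (\<lambda>w. - (ls k \<bullet> (A2 *v w + (A1 *v ?x1 - b)))
      + \<beta>s k / 2 * (norm (A2 *v w + (A1 *v ?x1 - b)))\<^sup>2)"
    by (simp add: phi_def add_diff_eq add.commute)
  then have g: "?g = transpose A2 *v (\<beta>s k *\<^sub>R (A2 *v snd ?xh + (A1 *v ?x1 - b)) - ls k)"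
    by (simp only: gradient_affine_quadratic)
  have min: "is_arg_min (\<lambda>w. f2 w + w \<bullet> ?g + \<beta>s k / 2 * wnorm2 D (w - snd ?xh)
      + ?s * wnorm2 R (w - snd (xs k))) (\<lambda>_. True) ?x"
    using algorithm k by (simp add: algorithm1_def Let_def)
  have "- (?g + \<beta>s k *\<^sub>R (D *v (?x - snd ?xh)) + (2 * ?s) *\<^sub>R (R *v (?x - snd (xs k))))
      \<in> subdifferential f2 ?x"
    by (rule argmin_subgradient[OF convex_f2 D_symmetric R_symmetric min])
  moreover have "?x - snd ?xh = \<tau> k *\<^sub>R (snd (xt k) - snd (xb k))"
    unfolding x_next[OF k] x_hat_eq[OF k] by (simp add: algebra_simps)
  \<comment> \<open>This gradient already sits at the new first and the extrapolated second block,
    so the proximal terms remain separate.\<close>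
  moreover have "- ?g = transpose A2 *v multiplier k"
    unfolding g multiplier_eq[OF k]
    by (simp add: matrix_vector_mult_diff_distrib
        matrix_vector_right_distrib matrix_vector_mult_scaleR algebra_simps
        del: transpose_matrix_vector)
  moreover have "2 * ?s = \<sigma> * (1 - \<tau> k) / \<tau> k" by simp
  ultimately show ?thesis by (simp add: matrix_vector_mult_scaleR mult.commute)
qed

text \<open>The proximal term weighted by \<open>\<sigma>\<close> is completed to a square by strong convexity used
  both at \<open>x\<close> and at the previous iterate.\<close>

lemma strong_convexity_gain:
  assumes k: "k \<ge> 0" and p: "p = (1 - \<tau> k) *\<^sub>R x0 + \<tau> k *\<^sub>R y"
  shows "1 / 2 * wnorm2 R (y - x) \<le> ((norm (x - p))\<^sup>2 + (1 - \<tau> k) / \<tau> k * (norm (x0 - p))\<^sup>2) / 2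
    - (1 - \<tau> k) / \<tau> k * ((R *v (p - x0)) \<bullet> (x - y))"
proof -
  define a e where "a = x - y" and "e = x0 - y"
  let ?t = "\<tau> k"
  have t: "0 < ?t" "?t \<le> 1" using k by (auto intro: tau_pos tau_le_1)
  have xp: "x - p = a + (- (1 - ?t)) *\<^sub>R e" and x0p: "x0 - p = 0 + ?t *\<^sub>R e"
    and px0: "p - x0 = (- ?t) *\<^sub>R e"
    by (simp_all add: p a_def e_def algebra_simps)
  have "1 / 2 * wnorm2 R (y - x) = wnorm2 R (0 + (-1) *\<^sub>R a) / 2" by (simp add: a_def)
  also have "\<dots> = wnorm2 R a / 2"
    unfolding wnorm2_add_scaleR[OF R_symmetric] by (simp add: wnorm2_def)
  also have "\<dots> \<le> wnorm2 R a / 2 + (1 - ?t) / 2 * wnorm2 R e"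
    using t R_bounds(1)[of e] by simp
  \<comment> \<open>The cross terms in \<open>a\<close> and \<open>e\<close> cancel, and
    \<open>(1 - ?t)\<^sup>2 + ?t * (1 - ?t) = 1 - ?t\<close> collects the squares of
    \<open>e\<close>.\<close>
  also have "\<dots> = (wnorm2 R (x - p) + (1 - ?t) / ?t * wnorm2 R (x0 - p)) / 2
    - (1 - ?t) / ?t * ((R *v (p - x0)) \<bullet> a)"
    unfolding xp x0p px0 wnorm2_add_scaleR[OF R_symmetric] matrix_vector_mult_scaleR
    using t inner_mult_symmetric[OF R_symmetric, of a e]
    by (simp add: wnorm2_def inner_commute power2_eq_square field_simps)
  also have "\<dots> \<le> ((norm (x - p))\<^sup>2 + (1 - ?t) / ?t * (norm (x0 - p))\<^sup>2) / 2
    - (1 - ?t) / ?t * ((R *v (p - x0)) \<bullet> a)"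
    using t R_bounds(2) by (intro diff_right_mono divide_right_mono add_mono mult_left_mono) auto
  finally show ?thesis by (simp add: a_def)
qed

text \<open>Add the averaged subgradient inequalities of the two blocks and absorb the
  \<sigma>-proximal term by \<open>strong_convexity_gain\<close>. Splitting
  \<open>multiplier\<close> into \<open>lt\<close> and its remainder yields the \<open>F\<close>
  term and the residual term.\<close>

lemma prediction_inequality:
  assumes k: "k \<ge> 0"
  shows "(stack (snd x) lam - vt k) \<bullet> (Q k *v (v k - vt k)) + \<sigma> / 2 * wnorm2 R (snd (xt k) - snd x)
    \<le> 1 / \<tau> k * (f x - f (xs (k + 1))) - (1 - \<tau> k) / \<tau> k * (f x - f (xs k))
      + ((x, lam) - (xt k, lt k)) \<bullet> F (xt k, lt k)
      + (1 - \<gamma>) * (1 - \<tau> k) * \<beta>s k * (A (x - xt k) \<bullet> (A (xs k) - b))"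
proof -
  let ?p = "multiplier k" and ?t = "\<tau> k" and ?c = "\<tau> k * \<beta>s k"
  let ?x1 = "fst x - fst (xt k)" and ?x2 = "snd x - snd (xt k)"
  let ?q = "xs (k + 1)"
  let ?dR = "R *v (snd ?q - snd (xs k))" and ?dD = "D *v (snd (xt k) - snd (xb k))"
  have t: "0 < ?t" "?t \<le> 1" and c: "?c \<noteq> 0"
    using k tau_pos[of k] tau_le_1[of k] beta_pos[of k] by auto
  let ?g2 = "transpose A2 *v ?p - ?c *\<^sub>R ?dD - (\<sigma> * (1 - ?t) / ?t) *\<^sub>R ?dR"
  \<comment> \<open>\<open>f1\<close> enters with convexity modulus 0.\<close>
  have 1: "(transpose A1 *v ?p) \<bullet> ?x1
      + 0 / 2 * ((norm (fst x - fst ?q))\<^sup>2 + (1 - ?t) / ?t * (norm (fst (xs k) - fst ?q))\<^sup>2)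
    \<le> 1 / ?t * (f1 (fst x) - f1 (fst ?q)) - (1 - ?t) / ?t * (f1 (fst x) - f1 (fst (xs k)))"
    using subgradient_f1[OF k] x_next[OF k] t
    by (intro subgradient_combination) (auto simp: subdifferential_def)
  have 2: "?g2 \<bullet> ?x2
      + \<sigma> / 2 * ((norm (snd x - snd ?q))\<^sup>2 + (1 - ?t) / ?t * (norm (snd (xs k) - snd ?q))\<^sup>2)
    \<le> 1 / ?t * (f2 (snd x) - f2 (snd ?q)) - (1 - ?t) / ?t * (f2 (snd x) - f2 (snd (xs k)))"
    using subgradient_f2[OF k] strongly_convex_f2 x_next[OF k] t
    by (intro subgradient_combination) (auto simp: strongly_convex_def)
  have ring: "\<sigma> * (a / 2 - (1 - ?t) / ?t * d) = \<sigma> / 2 * a - \<sigma> * (1 - ?t) / ?t * d" for a d :: real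
    using t by (simp add: field_simps)
  have "\<sigma> * (1 / 2 * wnorm2 R (snd (xt k) - snd x))
    \<le> \<sigma> * (((norm (snd x - snd ?q))\<^sup>2 + (1 - ?t) / ?t * (norm (snd (xs k) - snd ?q))\<^sup>2) / 2
      - (1 - ?t) / ?t * (?dR \<bullet> ?x2))"
    using sigma_nonneg x_next[OF k] by (intro mult_left_mono strong_convexity_gain[OF k]) auto
  then have 3: "\<sigma> / 2 * wnorm2 R (snd (xt k) - snd x)
    \<le> \<sigma> / 2 * ((norm (snd x - snd ?q))\<^sup>2 + (1 - ?t) / ?t * (norm (snd (xs k) - snd ?q))\<^sup>2)
      - \<sigma> * (1 - ?t) / ?t * (?dR \<bullet> ?x2)"
    unfolding ring by simp
  have 4: "?g2 \<bullet> ?x2 = ?p \<bullet> (A2 *v ?x2) - ?c * (?dD \<bullet> ?x2) - \<sigma> * (1 - ?t) / ?t * (?dR \<bullet> ?x2)"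
    by (simp only: inner_diff_left[of _ _ ?x2] inner_scaleR_left inner_transpose_mult)
  have 5: "?p \<bullet> (A1 *v ?x1) + ?p \<bullet> (A2 *v ?x2) = ?p \<bullet> A (x - xt k)"
    by (simp add: Aop_def inner_add_right)
  \<comment> \<open>The second row of \<open>Q\<close> maps \<open>v k - vt k\<close> to the
    residual of \<open>xt k\<close>, which is also the last component of \<open>F\<close>; the terms
    in \<open>lam\<close> therefore agree on both sides.\<close>
  have slack: "- A2 *v (snd (xb k) - snd (xt k)) + (1 / ?c) *\<^sub>R (lb k - lt k) = A (xt k) - b"
    unfolding lb_minus_lt uminus_matrix_vector_mult using c by simp
  have "D *v (snd (xb k) - snd (xt k)) = - ?dD"
    by (simp add: matrix_vector_mult_diff_distrib)
  then have 6: "(stack (snd x) lam - vt k) \<bullet> (Q k *v (v k - vt k))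
      = - (?c * (?dD \<bullet> ?x2)) + (lam - lt k) \<bullet> (A (xt k) - b)"
    unfolding Q_mat_def stack_diff block_matrix_mult_stack inner_stack
      scaleR_matrix_vector_assoc[symmetric] matrix_vector_mul_lid slack
    by (simp add: inner_commute[of ?x2])
  have 7: "((x, lam) - (xt k, lt k)) \<bullet> F (xt k, lt k)
      = - (lt k \<bullet> A (x - xt k)) + (lam - lt k) \<bullet> (A (xt k) - b)"
    using inner_transpose_mult[of A1 "lt k" ?x1] inner_transpose_mult[of A2 "lt k" ?x2]
    by (simp add: F_op_def inner_prod_def Aop_def inner_add_right inner_commute
        del: transpose_matrix_vector inner_diff_left inner_diff_right)
  have 8: "?p \<bullet> A (x - xt k) = lt k \<bullet> A (x - xt k)
      - (1 - \<gamma>) * (1 - ?t) * \<beta>s k * (A (x - xt k) \<bullet> (A (xs k) - b))"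
    by (simp only: multiplier_def inner_diff_left[of _ _ "A (x - xt k)"] inner_scaleR_left
        inner_commute[of "A (x - xt k)"])
  have 9: "1 / ?t * (f x - f ?q) - (1 - ?t) / ?t * (f x - f (xs k))
    = (1 / ?t * (f1 (fst x) - f1 (fst ?q)) - (1 - ?t) / ?t * (f1 (fst x) - f1 (fst (xs k))))
      + (1 / ?t * (f2 (snd x) - f2 (snd ?q)) - (1 - ?t) / ?t * (f2 (snd x) - f2 (snd (xs k))))"
    unfolding objective_def by (simp only: distrib_left right_diff_distrib)
  \<comment> \<open>\<open>d\<close> stands for the \<open>D\<close> term, \<open>r\<close> for the
    \<sigma>-proximal term, \<open>s\<close> for the strong convexity gain, \<open>w\<close> for the
    part retained, and \<open>m - g\<close> for the split of the multiplier term.\<close>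
  have combine: "- d + l + w \<le> a\<^sub>1 + a\<^sub>2 + (- m + l) + g"
    if "p\<^sub>1 + 0 / 2 * z \<le> a\<^sub>1" "p\<^sub>2 - d - r + s \<le> a\<^sub>2" "w \<le> s - r" "p\<^sub>1 + p\<^sub>2 = p" "p = m - g"
    for a\<^sub>1 a\<^sub>2 d g l m p p\<^sub>1 p\<^sub>2 r s w z :: real
    using that by simp
  show ?thesis
    unfolding 6 7 9 by (rule combine[OF 1[unfolded inner_transpose_mult] 2[unfolded 4] 3 5 8])
qed

section \<open>The correction step, the matrix identities and the \<open>G\<close>-form\<close>

lemma correction:
  assumes k: "k \<ge> 0"
  shows "v (k + 1) = v k - M k *v (v k - vt k)"
proof -
  have "lb (k + 1) = ls k - (\<gamma> * ((1 - \<tau> (k + 1)) * \<beta>s (k + 1))) *\<^sub>R (A (xs (k + 1)) - b)"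
    by (simp add: lambda_bar_def multiplier_const[OF k] mult.assoc)
  \<comment> \<open>After \<open>beta_step\<close>, \<open>A_next\<close> splits the residual; the
    part from \<open>xs k\<close> is exactly the one contained in \<open>lb k\<close>.\<close>
  also have "\<dots> = lb k - (\<gamma> * \<tau> k * \<beta>s k) *\<^sub>R (A (xt k) - b)"
    unfolding beta_step[OF k] A_next[OF k] by (simp add: lambda_bar_def algebra_simps)
  also have "\<dots> = lb k + (\<gamma> * \<tau> k * \<beta>s k) *\<^sub>R (A2 *v (snd (xb k) - snd (xt k))) - \<gamma> *\<^sub>R (lb k - lt k)"
    unfolding lb_minus_lt by (simp add: scaleR_add_right mult.assoc)
  finally have lb: "lb (k + 1) = \<dots>" .
  show ?thesis
    unfolding M_mat_def stack_diff block_matrix_mult_stack lb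
    by (simp add: x_tilde_def scaleR_matrix_vector_assoc[symmetric] uminus_matrix_vector_mult
        algebra_simps del: matrix_vector_mult_diff_distrib)
qed

lemma Q_eq: "k \<ge> 0 \<Longrightarrow> Q k = H k ** M k"
  using tau_pos[of k] beta_pos[of k] gamma_pos
  by (simp add: Q_mat_def H_mat_def M_mat_def block_matrix_mult scalar_matrix_assoc[symmetric]
      matrix_scalar_ac)

lemma G_eq: "k \<ge> 0 \<Longrightarrow> G k = transpose (Q k) + Q k - transpose (M k) ** H k ** M k"
  using tau_pos[of k] beta_pos[of k] gamma_pos
  \<comment> \<open>Folding \<open>H k ** M k\<close> into \<open>Q k\<close> leaves only the
    product \<open>transpose (M k) ** Q k\<close> to compute.\<close>
  unfolding matrix_mul_assoc[symmetric] Q_eq[symmetric]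
  by (simp add: G_mat_def Q_mat_def M_mat_def block_matrix_mult transpose_block_matrix
      block_matrix_add block_matrix_diff transpose_scalar transpose_uminus transpose_zero
      uminus_matrix_mult matrix_mult_uminus D_symmetric scalar_matrix_assoc[symmetric]
      matrix_scalar_ac)
    (simp add: vec_eq_iff block_matrix_def field_simps split: sum.split)

lemma wnorm2_G_ge:
  assumes k: "k \<ge> 0"
  shows "(1 - \<gamma>) * \<tau> k * \<beta>s k * (norm (A (xt k) - b))\<^sup>2 \<le> wnorm2 (G k) (v k - vt k)"
proof -
  define c d s t w where "c = \<tau> k * \<beta>s k" and "d = snd (xb k) - snd (xt k)"
    and "s = A (xt k) - b" and "t = A2 *v d"
    and "w = s + t"
  have c: "0 < c" using k tau_pos[of k] beta_pos[of k] by (simp add: c_def)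
  have y: "lb k - lt k = c *\<^sub>R w" by (simp only: lb_minus_lt c_def d_def s_def t_def w_def)
  have t: "d \<bullet> (transpose A2 *v w) = t \<bullet> w" for w
    using inner_transpose_mult[of A2 w d] by (simp add: t_def inner_commute)
  have sq: "(2 - \<gamma>) / c * ((c *\<^sub>R w) \<bullet> (c *\<^sub>R w)) = (2 - \<gamma>) * c * (w \<bullet> w)" for w :: "real^'l"
    using c by simp
  have "wnorm2 (G k) (v k - vt k) = c * (wnorm2 D d - \<gamma> * (t \<bullet> t))
      - 2 * (1 - \<gamma>) * (t \<bullet> (c *\<^sub>R w)) + (2 - \<gamma>) / c * ((c *\<^sub>R w) \<bullet> (c *\<^sub>R w))"
    unfolding stack_diff d_def[symmetric] y G_mat_def c_def[symmetric] wnorm2_def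
      block_matrix_mult_stack inner_stack
    by (simp add: scaleR_matrix_vector_assoc[symmetric] matrix_vector_mult_diff_rdistrib
        matrix_vector_mul_assoc[symmetric] t t_def[symmetric] inner_simps inner_commute algebra_simps
        del: transpose_matrix_vector)
  \<comment> \<open>With \<open>w = s + t\<close> both sides equal \<open>c * ((2 - \<gamma>) * (s
    \<bullet> s) + 2 * (s \<bullet> t) + wnorm2 D d)\<close>; the squares of \<open>t\<close>
    cancel.\<close>
  also have "\<dots> = (1 - \<gamma>) * c * (s \<bullet> s) + c * (wnorm2 D d - t \<bullet> t) + c * (w \<bullet> w)"
    using c unfolding sq w_def by (simp add: inner_add_left inner_add_right inner_commute algebra_simps)
  also have "\<dots> \<ge> (1 - \<gamma>) * c * (s \<bullet> s)"
    using c D_ge[of d] by (simp add: t_def power2_norm_eq_inner)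
  finally show ?thesis by (simp add: c_def s_def power2_norm_eq_inner mult.assoc)
qed

lemma wnorm2_H:
  "wnorm2 (H k) (stack p q) = \<tau> k * \<beta>s k * wnorm2 D p + 1 / (\<gamma> * \<tau> k * \<beta>s k) * (q \<bullet> q)"
  by (simp add: H_mat_def wnorm2_def block_matrix_mult_stack inner_stack
      scaleR_matrix_vector_assoc[symmetric])

end

section \<open>Consequences of the two step-size rules\<close>

lemma constant_rate_steps:
  fixes \<tau> :: "int \<Rightarrow> real"
  assumes "0 < \<tau> (-1)" "\<tau> (-1) < 1" "\<forall>k\<ge>0. 1 / \<tau> (k - 1) = (1 - \<tau> k) / \<tau> k"
    and "k \<ge> -1"
  shows "0 < \<tau> k \<and> \<tau> k \<le> 1"
  using \<open>k \<ge> -1\<close>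
proof (induction k rule: int_ge_induct)
  case base
  then show ?case using assms by simp
next
  case (step i)
  then have "1 / \<tau> i = (1 - \<tau> (i + 1)) / \<tau> (i + 1)"
    using assms(3)[rule_format, of "i + 1"] by simp
  moreover have "0 < 1 / \<tau> i" using step by simp
  ultimately have "0 < (1 - \<tau> (i + 1)) / \<tau> (i + 1)" by simp
  \<comment> \<open>Numerator and denominator share a sign, and both cannot be negative; so
    positivity propagates along the recursion.\<close>
  then show ?case unfolding zero_less_divide_iff by linarith
qed

text \<open>The squared denominator hides the sign of \<open>t\<close>, so here the recursion gives
  only the upper bound and positivity is an assumption.\<close>

lemma quadratic_rate_step_le_1:
  fixes s t :: real
  assumes "0 < s" "0 < t" "1 / s\<^sup>2 = (1 - t) / t\<^sup>2"
  shows "t \<le> 1"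
proof -
  have "0 < (1 - t) / t\<^sup>2" unfolding assms(3)[symmetric] using assms(1) by simp
  then show ?thesis using assms(2) by (simp add: zero_less_divide_iff)
qed

text \<open>Partial sums starting from the empty sum at index 0; they supply \<Theta> with
  increments equal to the prescribed lower bound.\<close>

lemma nonneg_antidifference:
  fixes e :: "int \<Rightarrow> real"
  assumes "\<And>k. k \<ge> 0 \<Longrightarrow> e k \<ge> 0"
  shows "\<exists>\<Theta>. \<forall>k\<ge>0. \<Theta> k \<ge> 0 \<and> \<Theta> (k + 1) - \<Theta> k = e k"
proof (intro exI allI impI conjI)
  fix k :: int assume "k \<ge> 0"
  show "0 \<le> (\<Sum>j<nat k. e (int j))" using assms by (intro sum_nonneg) simp
  show "(\<Sum>j<nat (k + 1). e (int j)) - (\<Sum>j<nat k. e (int j)) = e k"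
    using \<open>k \<ge> 0\<close> by (simp add: nat_add_distrib)
qed

text \<open>The recursion at \<open>k + 1\<close> gives \<open>\<beta> * (1 - \<tau> (k + 1)) /
  \<tau> (k + 1) = \<beta> / \<tau> k\<close>, which is \<open>beta_step\<close>.\<close>

lemma constant_rate_iterates:
  assumes "closed_proper_convex f1" "closed_proper_convex f2" "\<sigma> \<ge> 0" "strongly_convex \<sigma> f2"
    "0 < \<gamma>" "\<gamma> \<le> 1" "D = transpose A2 ** A2 \<or> D = (spectral_norm A2)\<^sup>2 *\<^sub>R mat 1"
    "\<forall>k\<ge>0. \<beta>s k > 0" "algorithm1 A1 A2 b f1 f2 \<sigma> D \<tau> \<beta>s xs ls"
    and bs: "\<And>k. k \<ge> 0 \<Longrightarrow> \<beta>s k = \<beta> / \<tau> k"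
    and rate: "\<And>k. k \<ge> 0 \<Longrightarrow> 1 / \<tau> (k - 1) = (1 - \<tau> k) / \<tau> k"
    and tau: "\<And>k. k \<ge> -1 \<Longrightarrow> 0 < \<tau> k \<and> \<tau> k \<le> 1"
  shows "primal_dual_iterates f1 f2 A1 A2 b D \<gamma> \<sigma> \<tau> \<beta>s xs ls"
proof
  show "(1 - \<tau> (k + 1)) * \<beta>s (k + 1) = \<beta>s k" if "k \<ge> 0" for k
  proof -
    have "(1 - \<tau> (k + 1)) * \<beta>s (k + 1) = \<beta> * ((1 - \<tau> (k + 1)) / \<tau> (k + 1))"
      using bs[of "k + 1"] that by simp
    also have "\<dots> = \<beta> * (1 / \<tau> k)" using rate[of "k + 1"] that by simp
    finally show ?thesis using bs that by simp
  qed
qed (use assms in \<open>auto simp: closed_proper_convex_def\<close>)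

lemma pos_from_minus_1:
  fixes \<tau> :: "int \<Rightarrow> real"
  assumes "0 < \<tau> (-1)" "\<forall>k\<ge>0. 0 < \<tau> k" "k \<ge> -1"
  shows "0 < \<tau> k"
  using assms by (cases "k = -1") auto

lemma quadratic_rate_iterates:
  assumes "closed_proper_convex f1" "closed_proper_convex f2" "\<sigma> \<ge> 0" "strongly_convex \<sigma> f2"
    "0 < \<gamma>" "\<gamma> \<le> 1" "D = transpose A2 ** A2 \<or> D = (spectral_norm A2)\<^sup>2 *\<^sub>R mat 1"
    "\<forall>k\<ge>0. \<beta>s k > 0" "algorithm1 A1 A2 b f1 f2 \<sigma> D \<tau> \<beta>s xs ls"
    and bs: "\<And>k. k \<ge> 0 \<Longrightarrow> \<beta>s k = \<beta> / (\<tau> k)\<^sup>2"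
    and rate: "\<And>k. k \<ge> 0 \<Longrightarrow> 1 / (\<tau> (k - 1))\<^sup>2 = (1 - \<tau> k) / (\<tau> k)\<^sup>2"
    and tau: "\<And>k. k \<ge> -1 \<Longrightarrow> 0 < \<tau> k"
  shows "primal_dual_iterates f1 f2 A1 A2 b D \<gamma> \<sigma> \<tau> \<beta>s xs ls"
proof
  show "(1 - \<tau> (k + 1)) * \<beta>s (k + 1) = \<beta>s k" if "k \<ge> 0" for k
  proof -
    have "(1 - \<tau> (k + 1)) * \<beta>s (k + 1) = \<beta> * ((1 - \<tau> (k + 1)) / (\<tau> (k + 1))\<^sup>2)"
      using bs[of "k + 1"] that by simp
    also have "\<dots> = \<beta> * (1 / (\<tau> k)\<^sup>2)" using rate[of "k + 1"] that by simp
    finally show ?thesis using bs that by simp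
  qed
  show "\<tau> k \<le> 1" if "k \<ge> 0" for k
    using that by (intro quadratic_rate_step_le_1[OF tau tau rate]) auto
qed (use assms in \<open>auto simp: closed_proper_convex_def\<close>)

section \<open>Specialization of the one-step estimates to both regimes\<close>

theorem theorem5p1:
  fixes f1 :: "real^'n \<Rightarrow> real" and f2 :: "real^'m \<Rightarrow> real"
    and A1 :: "real^'n^'l" and A2 :: "real^'m^'l" and b :: "real^'l"
    and D :: "real^'m^'m" and \<gamma> \<sigma> \<beta> :: real
    and \<tau> \<beta>s :: "int \<Rightarrow> real"
    and xs :: "int \<Rightarrow> (real^'n) \<times> (real^'m)" and ls :: "int \<Rightarrow> real^'l"
  assumes "closed_proper_convex f1" and "closed_proper_convex f2"
    and "\<sigma> \<ge> 0" and "strongly_convex \<sigma> f2"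
    and "0 < \<gamma>" and "\<gamma> \<le> 1"
    and "D = transpose A2 ** A2 \<or> D = (spectral_norm A2)\<^sup>2 *\<^sub>R mat 1"
    and "\<forall>k\<ge>0. \<beta>s k > 0"
    and "algorithm1 A1 A2 b f1 f2 \<sigma> D \<tau> \<beta>s xs ls"
  shows
    "let f = objective f1 f2; A = Aop A1 A2; F = F_op A1 A2 b; \<Omega> = feasible_set A1 A2 b;
         xbr = x_breve xs; xt = x_tilde \<tau> xs; xb = x_bar \<tau> xs;
         lb = lambda_bar A1 A2 b \<gamma> \<tau> \<beta>s xs ls; lt = lambda_tilde A1 A2 b \<gamma> \<tau> \<beta>s xs ls;
         v = (\<lambda>k. stack (snd (xb k)) (lb k)); vt = (\<lambda>k. stack (snd (xt k)) (lt k));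
         ut = (\<lambda>k. (xt k, lt k));
         Q = Q_mat A2 D \<tau> \<beta>s; M = M_mat A2 \<gamma> \<tau> \<beta>s;
         H = (H_mat D \<gamma> \<tau> \<beta>s :: int \<Rightarrow> real^('m + 'l)^('m + 'l)); G = G_mat A2 D \<gamma> \<tau> \<beta>s
     in
     (\<beta> > 0 \<and> (\<forall>k\<ge>0. \<beta>s k = \<beta> / \<tau> k) \<and> 0 < \<tau> (-1) \<and> \<tau> (-1) < 1 \<and>
      (\<forall>k\<ge>0. 1 / \<tau> (k - 1) = (1 - \<tau> k) / \<tau> k)
      \<longrightarrow>
      (let c = (\<lambda>k. (1 - \<gamma>) * (1 - \<tau> k) * \<beta>s k); H0 = H in
       (\<forall>k\<ge>0.
          xt k = (1 / \<tau> k) *\<^sub>R xbr k - ((1 - \<tau> k) / \<tau> k) *\<^sub>R xbr (k - 1) \<and>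
          (\<forall>x lam.
             1 / \<tau> k * (f x - f (xbr k)) - 1 / \<tau> (k - 1) * (f x - f (xbr (k - 1)))
               + ((x, lam) - ut k) \<bullet> F (ut k)
               + c k * (A (x - xt k) \<bullet> (A (xbr (k - 1)) - b))
             \<ge> (stack (snd x) lam - vt k) \<bullet> (Q k *v (v k - vt k))) \<and>
          v (k + 1) = v k - M k *v (v k - vt k) \<and>
          Q k = H k ** M k \<and>
          G k = transpose (Q k) + Q k - transpose (M k) ** H k ** M k \<and>
          H0 k = block_matrix (\<beta> *\<^sub>R D) 0 0 ((1 / (\<gamma> * \<beta>)) *\<^sub>R mat 1)) \<and>
       (\<exists>\<Theta>. \<forall>k\<ge>0.
          \<Theta> k \<ge> 0 \<and>
          \<Theta> (k + 1) - \<Theta> k \<ge> (1 - \<gamma>) * \<tau> k * \<beta>s k * (norm (A (xt k) - b))\<^sup>2 \<and>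
          (\<forall>x'\<in>\<Omega>. \<forall>lam. let v' = stack (snd x') lam in
             wnorm2 (H k) (v (k + 1) - v') - wnorm2 (H k) (v k - v') + wnorm2 (G k) (v k - vt k)
             \<ge> wnorm2 (H0 (k + 1)) (v (k + 1) - v') - wnorm2 (H0 k) (v k - v')
               + \<Theta> (k + 1) - \<Theta> k))))
     \<and>
     (\<sigma> > 0 \<and> \<beta> > 0 \<and> (\<forall>k\<ge>0. \<beta>s k = \<beta> / (\<tau> k)\<^sup>2) \<and>
      (\<forall>k\<ge>0. 1 / \<tau> k * (\<beta> / \<tau> k + \<sigma> / sigma_max D) \<ge> \<beta> / (\<tau> (k + 1))\<^sup>2) \<and>
      (\<forall>k\<ge>0. \<tau> k > 0) \<and> 0 < \<tau> (-1) \<and> \<tau> (-1) < 1 \<and>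
      (\<forall>k\<ge>0. 1 / (\<tau> (k - 1))\<^sup>2 = (1 - \<tau> k) / (\<tau> k)\<^sup>2)
      \<longrightarrow>
      (let c = (\<lambda>k. (1 - \<gamma>) * (1 - \<tau> k) * \<beta>s k / \<tau> k); R = normalized_matrix D;
           z = (\<lambda>k. snd (xt k)); H0 = (\<lambda>k. (1 / \<tau> k) *\<^sub>R H k) in
       (\<forall>k\<ge>0.
          xt k = (1 / \<tau> k) *\<^sub>R xbr k - ((1 - \<tau> k) / \<tau> k) *\<^sub>R xbr (k - 1) \<and>
          (\<forall>x lam.
             1 / (\<tau> k)\<^sup>2 * (f x - f (xbr k)) - 1 / (\<tau> (k - 1))\<^sup>2 * (f x - f (xbr (k - 1)))
               + 1 / \<tau> k * (((x, lam) - ut k) \<bullet> F (ut k))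
               + c k * (A (x - xt k) \<bullet> (A (xbr (k - 1)) - b))
             \<ge> 1 / \<tau> k * ((stack (snd x) lam - vt k) \<bullet> (Q k *v (v k - vt k))
                         + \<sigma> / 2 * wnorm2 R (z k - snd x))) \<and>
          v (k + 1) = v k - M k *v (v k - vt k) \<and>
          Q k = H k ** M k \<and>
          G k = transpose (Q k) + Q k - transpose (M k) ** H k ** M k \<and>
          H0 k = block_matrix ((\<beta> / (\<tau> k)\<^sup>2) *\<^sub>R D) 0 0 ((1 / (\<gamma> * \<beta>)) *\<^sub>R mat 1)) \<and>
       (\<exists>\<Theta>. \<forall>k\<ge>0.
          \<Theta> k \<ge> 0 \<and>
          \<Theta> (k + 1) - \<Theta> k \<ge> (1 - \<gamma>) * \<beta>s k * (norm (A (xt k) - b))\<^sup>2 \<and>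
          (\<forall>x'\<in>\<Omega>. \<forall>lam. let v' = stack (snd x') lam; z' = snd x' in
             1 / \<tau> k * (wnorm2 (H k) (v (k + 1) - v') + \<sigma> * wnorm2 R (z k - z')
                        - wnorm2 (H k) (v k - v') + wnorm2 (G k) (v k - vt k))
             \<ge> wnorm2 (H0 (k + 1)) (v (k + 1) - v') - wnorm2 (H0 k) (v k - v')
               + \<Theta> (k + 1) - \<Theta> k))))"
proof (unfold Let_def, intro conjI impI, goal_cases)
  \<comment> \<open>Cases 1 and 2 treat the first regime, 3 and 4 the second; odd cases hold the
    one-step statements, even ones the existence of \<Theta>.\<close>
  case 1
  then have bs: "\<And>k. k \<ge> 0 \<Longrightarrow> \<beta>s k = \<beta> / \<tau> k"
    and rate: "\<And>k. k \<ge> 0 \<Longrightarrow> 1 / \<tau> (k - 1) = (1 - \<tau> k) / \<tau> k"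
    and tau: "\<And>k. k \<ge> -1 \<Longrightarrow> 0 < \<tau> k \<and> \<tau> k \<le> 1"
    using constant_rate_steps[of \<tau>] by auto
  interpret primal_dual_iterates f1 f2 A1 A2 b D \<gamma> \<sigma> \<tau> \<beta>s xs ls
    by (rule constant_rate_iterates[where \<beta> = \<beta>, OF assms bs rate tau])
  show ?case
  proof (intro allI impI conjI, goal_cases)
    case (1 k) show ?case using xt_eq[of k] by (simp add: x_breve_def)
  next
    case (2 k x lam)
    \<comment> \<open>In this regime the \<sigma>-term of the prediction inequality is nonnegative
      and is dropped.\<close>
    have "0 \<le> \<sigma> / 2 * wnorm2 R (snd (xt k) - snd x)"
      using sigma_nonneg R_bounds(1) by simp
    with prediction_inequality[OF 2, of x lam] rate[OF 2] show ?case
      by (simp add: x_breve_def)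
  next
    case (3 k) then show ?case by (rule correction)
  next
    case (4 k) then show ?case by (rule Q_eq)
  next
    case (5 k) then show ?case by (rule G_eq)
  next
    case (6 k) then show ?case using tau[of k] bs[of k] by (simp add: H_mat_def mult.assoc)
  qed
next
  case 2
  then have bs: "\<And>k. k \<ge> 0 \<Longrightarrow> \<beta>s k = \<beta> / \<tau> k"
    and rate: "\<And>k. k \<ge> 0 \<Longrightarrow> 1 / \<tau> (k - 1) = (1 - \<tau> k) / \<tau> k"
    and tau: "\<And>k. k \<ge> -1 \<Longrightarrow> 0 < \<tau> k \<and> \<tau> k \<le> 1"
    using constant_rate_steps[of \<tau>] by auto
  interpret primal_dual_iterates f1 f2 A1 A2 b D \<gamma> \<sigma> \<tau> \<beta>s xs ls
    by (rule constant_rate_iterates[where \<beta> = \<beta>, OF assms bs rate tau])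
  let ?e = "\<lambda>k. (1 - \<gamma>) * \<tau> k * \<beta>s k * (norm (A (xt k) - b))\<^sup>2"
  have "0 \<le> ?e k" if "k \<ge> 0" for k
    using gamma_le_1 tau[of k] beta_pos[of k] that by simp
  then obtain \<Theta> where \<Theta>: "\<And>k. k \<ge> 0 \<Longrightarrow> \<Theta> k \<ge> 0 \<and> \<Theta> (k + 1) - \<Theta> k = ?e k"
    using nonneg_antidifference[of ?e] by blast
  \<comment> \<open>Since \<open>\<tau> k * \<beta>s k = \<beta>\<close>, the weighted distances to
    \<open>v'\<close> agree on both sides and only the \<open>G\<close>-form has to cover the
    increment of \<Theta>.\<close>
  have H_const: "H (k + 1) = H k" if "k \<ge> 0" for k
    using that tau[of k] tau[of "k + 1"] bs[of k] bs[of "k + 1"] by (simp add: H_mat_def mult.assoc)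
  show ?case
  proof (intro exI[of _ \<Theta>] allI impI conjI ballI, goal_cases)
    case (1 k) then show ?case using \<Theta> by simp
  next
    case (2 k) then show ?case using \<Theta> by simp
  next
    case (3 k x' lam)
    then show ?case using \<Theta>[of k] wnorm2_G_ge[of k] by (simp add: H_const)
  qed
next
  case 3
  then have beta: "\<beta> > 0" and bs: "\<And>k. k \<ge> 0 \<Longrightarrow> \<beta>s k = \<beta> / (\<tau> k)\<^sup>2"
    and tau: "\<And>k. k \<ge> -1 \<Longrightarrow> 0 < \<tau> k"
    and rate: "\<And>k. k \<ge> 0 \<Longrightarrow> 1 / (\<tau> (k - 1))\<^sup>2 = (1 - \<tau> k) / (\<tau> k)\<^sup>2"
    by (auto simp: pos_from_minus_1)
  interpret primal_dual_iterates f1 f2 A1 A2 b D \<gamma> \<sigma> \<tau> \<beta>s xs ls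
    by (rule quadratic_rate_iterates[where \<beta> = \<beta>, OF assms bs rate tau])
  show ?case
  proof (intro allI impI conjI, goal_cases)
    case (1 k) show ?case using xt_eq[of k] by (simp add: x_breve_def)
  next
    case (2 k x lam)
    have t: "0 < \<tau> k" using 2 tau by simp
    \<comment> \<open>The claim is the prediction inequality multiplied by
      \<open>1 / \<tau> k\<close>; the recursion rewrites the previous weight.\<close>
    have scale: "1 / (\<tau> k)\<^sup>2 * p - 1 / (\<tau> (k - 1))\<^sup>2 * q + 1 / \<tau> k * r
        + (1 - \<gamma>) * (1 - \<tau> k) * \<beta>s k / \<tau> k * s
      = 1 / \<tau> k * (1 / \<tau> k * p - (1 - \<tau> k) / \<tau> k * q + r
        + (1 - \<gamma>) * (1 - \<tau> k) * \<beta>s k * s)" for p q r s :: real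
      unfolding rate[OF 2] using t by (simp add: power2_eq_square field_simps)
    show ?case
      unfolding scale x_breve_def using t prediction_inequality[OF 2, of x lam]
      by (intro mult_left_mono) simp_all
  next
    case (3 k) then show ?case by (rule correction)
  next
    case (4 k) then show ?case by (rule Q_eq)
  next
    case (5 k) then show ?case by (rule G_eq)
  next
    case (6 k) then show ?case using tau[of k] beta gamma_pos
      by (simp add: bs H_mat_def block_matrix_scaleR power2_eq_square)
  qed
next
  case 4
  then have beta: "\<beta> > 0" and bs: "\<And>k. k \<ge> 0 \<Longrightarrow> \<beta>s k = \<beta> / (\<tau> k)\<^sup>2"
    and growth: "\<And>k. k \<ge> 0 \<Longrightarrow> \<beta> / (\<tau> (k + 1))\<^sup>2 \<le> 1 / \<tau> k * (\<beta> / \<tau> k + \<sigma> / sigma_max D)"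
    and tau: "\<And>k. k \<ge> -1 \<Longrightarrow> 0 < \<tau> k"
    and rate: "\<And>k. k \<ge> 0 \<Longrightarrow> 1 / (\<tau> (k - 1))\<^sup>2 = (1 - \<tau> k) / (\<tau> k)\<^sup>2"
    by (auto simp: pos_from_minus_1)
  interpret primal_dual_iterates f1 f2 A1 A2 b D \<gamma> \<sigma> \<tau> \<beta>s xs ls
    by (rule quadratic_rate_iterates[where \<beta> = \<beta>, OF assms bs rate tau])
  let ?e = "\<lambda>k. (1 - \<gamma>) * \<beta>s k * (norm (A (xt k) - b))\<^sup>2"
  have "0 \<le> ?e k" if "k \<ge> 0" for k
    using gamma_le_1 beta_pos[of k] that by simp
  then obtain \<Theta> where \<Theta>: "\<And>k. k \<ge> 0 \<Longrightarrow> \<Theta> k \<ge> 0 \<and> \<Theta> (k + 1) - \<Theta> k = ?e k"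
    using nonneg_antidifference[of ?e] by blast
  \<comment> \<open>After scaling, only the \<open>D\<close> block depends on \<open>k\<close>; the
    multiplier block has constant weight.\<close>
  have H0: "1 / \<tau> k * wnorm2 (H k) (stack p q) = \<beta> / (\<tau> k)\<^sup>2 * wnorm2 D p + 1 / (\<gamma> * \<beta>) * (q \<bullet> q)"
    if "k \<ge> 0" for k p q
    unfolding wnorm2_H using that tau[of k] beta gamma_pos
    by (simp add: bs power2_eq_square field_simps)
  show ?case
  proof (intro exI[of _ \<Theta>] allI impI conjI ballI, goal_cases)
    case (1 k) then show ?case using \<Theta> by simp
  next
    case (2 k) then show ?case using \<Theta> by simp
  next
    case (3 k x' lam)
    let ?p = "snd (xt k) - snd x'" and ?q = "lb (k + 1) - lam"
    have t: "0 < \<tau> k" using 3 tau by simp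
    have "?e k = 1 / \<tau> k * ((1 - \<gamma>) * \<tau> k * \<beta>s k * (norm (A (xt k) - b))\<^sup>2)" using t by simp
    also have "\<dots> \<le> 1 / \<tau> k * wnorm2 (G k) (v k - vt k)"
      using t by (intro mult_left_mono wnorm2_G_ge 3) simp
    finally have G: "\<Theta> (k + 1) - \<Theta> k \<le> 1 / \<tau> k * wnorm2 (G k) (v k - vt k)"
      using \<Theta>[of k] 3 by simp
    \<comment> \<open>As \<open>xb (k + 1) = xt k\<close>, the first block is the vector measured by
      the \<sigma>-term, which can thus pay for the growth of the \<open>D\<close> weight.\<close>
    have next_diff: "v (k + 1) - stack (snd x') lam = stack ?p ?q"
      by (simp add: stack_diff x_tilde_def)
    have "\<beta> / (\<tau> (k + 1))\<^sup>2 * wnorm2 D ?p \<le> 1 / \<tau> k * (\<beta> / \<tau> k + \<sigma> / sigma_max D) * wnorm2 D ?p"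
      by (intro mult_right_mono growth 3 D_psd)
    also have "\<dots> = \<beta> / (\<tau> k)\<^sup>2 * wnorm2 D ?p + 1 / \<tau> k * (\<sigma> * wnorm2 R ?p)"
      unfolding wnorm2_normalized_matrix by (simp add: power2_eq_square distrib_left distrib_right)
    finally have "1 / \<tau> (k + 1) * wnorm2 (H (k + 1)) (stack ?p ?q)
      \<le> 1 / \<tau> k * wnorm2 (H k) (stack ?p ?q) + 1 / \<tau> k * (\<sigma> * wnorm2 R ?p)"
      using 3 by (simp only: H0 add_increasing)
    with G show ?case
      unfolding next_diff wnorm2_scaleR_mat distrib_left right_diff_distrib by linarith
  qed
qed

end
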